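(* Let $(\mathcal{A},L)$ be a compact quantum metric space and let $\tau$ be a faithful trace on $\mathcal{A}$. If $\mathcal{A}$ is finite dimensional, then the quantum metric $d_L^\tau$ and the C*-norm metric $d_{\mathcal{A}}$ on $D_\tau(\mathcal{A})$ are topologically equivalent.
   Context: A compact quantum metric space is a pair $(\mathcal{A},L)$ where $\mathcal{A}$ is a unital C*-algebra and $L:\mathcal{A}\to[0,\infty]$ is a seminorm such that: (1) $\{a\in\mathcal{A}: L(a)<\infty\}$ is dense in $\mathcal{A}$; (2) $L(a)=0$ if and only if $a\in\mathbb{C}1_{\mathcal{A}}$; (3) $L(a)=L(a^* )$ for all $a\in\mathcal{A}$; (4) the Monge–Kantorovich metric, defined for $\varphi,\psi$ in the state space $S(\mathcal{A})$ by $mk_L(\varphi,\psi)=\sup\{|\varphi(a)-\psi(a)| : a\in\mathcal{A},\ L(a)\leq 1\}$, metrizes the weak* topology on $S(\mathcal{A})$. A faithful trace $\tau$ is a positive linear functional with $\tau(ab)=\tau(ba)$ for all $a,b$, and $\tau(a^*a)=0$ only if $a=0$ (not necessarily of norm $1$). The density space is $D_\tau(\mathcal{A})=\{a\in\mathcal{A}_+:\tau(a)=1\}$, where $\mathcal{A}_+$ is the set of positive elements. For $a\in D_\tau(\mathcal{A})$, $\varphi_a^\tau$ is the state $\varphi_a^\tau(b)=\tau(ab)$, $b\in\mathcal{A}$. The quantum metric on $D_\tau(\mathcal{A})$ is $d_L^\tau(x,y)=mk_L(\varphi_x^\tau,\varphi_y^\tau)$ (a metric, since $a\mapsto\varphi_a^\tau$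 is an injective map $D_\tau(\mathcal{A})\to S(\mathcal{A})$). The C*-norm metric is $d_{\mathcal{A}}(x,y)=\|x-y\|_{\mathcal{A}}$, restricted to $D_\tau(\mathcal{A})$. Two metrics on a set are topologically equivalent if they induce the same topology. *)

theory Defs
  imports "HOL-Analysis.Analysis"
begin

text \<open>
  Unital C*-algebras, as a type class over the real normed algebras of the library. The zero
  algebra is not excluded, and \<open>norm 1 = 1\<close> is not assumed: it follows from the C*-identity
  as soon as \<open>1 \<noteq> 0\<close>.
\<close>

class scaleC =
  fixes scaleC :: "complex \<Rightarrow> 'a \<Rightarrow> 'a" (infixr \<open>*\<^sub>C\<close> 75)

class star =
  fixes star :: "'a \<Rightarrow> 'a"

class unital_cstar_algebra = real_normed_algebra + banach + monoid_mult + scaleC + star +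
  assumes scaleC_add_right: "c *\<^sub>C (x + y) = c *\<^sub>C x + c *\<^sub>C y"
    and scaleC_add_left: "(c + d) *\<^sub>C x = c *\<^sub>C x + d *\<^sub>C x"
    and scaleC_scaleC: "c *\<^sub>C d *\<^sub>C x = (c * d) *\<^sub>C x"
    and scaleC_one: "1 *\<^sub>C x = x"
    and scaleR_scaleC: "r *\<^sub>R x = complex_of_real r *\<^sub>C x"
    and mult_scaleC_left: "(c *\<^sub>C x) * y = c *\<^sub>C (x * y)"
    and mult_scaleC_right: "x * (c *\<^sub>C y) = c *\<^sub>C (x * y)"
    and norm_scaleC: "norm (c *\<^sub>C x) = cmod c * norm x"
    and star_star: "star (star x) = x"
    and star_add: "star (x + y) = star x + star y"
    and star_scaleC: "star (c *\<^sub>C x) = cnj c *\<^sub>C star x"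
    and star_mult: "star (x * y) = star y * star x"
    and cstar_identity: "norm (star x * x) = (norm x)\<^sup>2"

global_interpretation complex_vector:
  vector_space "scaleC :: complex \<Rightarrow> 'a \<Rightarrow> 'a::unital_cstar_algebra"
  by unfold_locales
    (rule scaleC_add_right scaleC_add_left scaleC_scaleC scaleC_one)+

text \<open>
  In a C*-algebra the elements \<open>star b * b\<close> are exactly the self-adjoint elements with
  nonnegative spectrum.
\<close>

definition positive_elements :: "'a::unital_cstar_algebra set" where
  "positive_elements = {star b * b | b. True}"

definition positive_functional :: "('a::unital_cstar_algebra \<Rightarrow> complex) \<Rightarrow> bool" where
  "positive_functional \<phi> \<longleftrightarrow>
     Vector_Spaces.linear scaleC (*) \<phi> \<and> (\<forall>a\<in>positive_elements. \<phi> a \<in> \<real>\<^sub>\<ge>\<^sub>0)"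

text \<open>For positive functionals on a unital C*-algebra, \<open>\<phi> 1\<close> is the norm of \<open>\<phi>\<close>.\<close>

definition state_space :: "('a::unital_cstar_algebra \<Rightarrow> complex) set" where
  "state_space = {\<phi>. positive_functional \<phi> \<and> \<phi> 1 = 1}"

text \<open>The weak* topology is the topology of pointwise convergence.\<close>

definition weak_star_topology :: "('a::unital_cstar_algebra \<Rightarrow> complex) topology" where
  "weak_star_topology = subtopology (product_topology (\<lambda>_. euclidean) UNIV) state_space"

definition mk ::
    "('a::unital_cstar_algebra \<Rightarrow> ennreal) \<Rightarrow> ('a \<Rightarrow> complex) \<Rightarrow> ('a \<Rightarrow> complex) \<Rightarrow> ennreal" where
  "mk L \<phi> \<psi> = (SUP a\<in>{a. L a \<le> 1}. ennreal (cmod (\<phi> a - \<psi> a)))"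

text \<open>
  In \<open>ennreal\<close> we have \<open>0 * \<infinity> = 0\<close>, so homogeneity is the usual convention for extended
  seminorms. Metrics in the library are real-valued and \<open>enn2real \<infinity> = 0\<close>; hence finiteness of
  \<open>mk\<close> on the state space is a separate part of the requirement that it metrize the weak*
  topology.
\<close>

locale compact_quantum_metric_space =
  fixes L :: "'a::unital_cstar_algebra \<Rightarrow> ennreal"
  assumes L_add: "L (a + b) \<le> L a + L b"
    and L_scaleC: "L (c *\<^sub>C a) = ennreal (cmod c) * L a"
    and L_dense: "closure {a. L a < \<infinity>} = UNIV"
    and L_eq_0_iff: "L a = 0 \<longleftrightarrow> a \<in> range (\<lambda>c. c *\<^sub>C 1)"
    and L_star: "L a = L (star a)"
    and mk_finite: "\<phi> \<in> state_space \<Longrightarrow> \<psi> \<in> state_space \<Longrightarrow> mk L \<phi> \<psi> < \<infinity>"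
    and mk_metric: "Metric_space state_space (\<lambda>\<phi> \<psi>. enn2real (mk L \<phi> \<psi>))"
    and mk_metrizes:
      "Metric_space.mtopology state_space (\<lambda>\<phi> \<psi>. enn2real (mk L \<phi> \<psi>)) = weak_star_topology"

definition faithful_trace :: "('a::unital_cstar_algebra \<Rightarrow> complex) \<Rightarrow> bool" where
  "faithful_trace \<tau> \<longleftrightarrow>
     positive_functional \<tau> \<and> (\<forall>a b. \<tau> (a * b) = \<tau> (b * a)) \<and>
     (\<forall>a. \<tau> (star a * a) = 0 \<longrightarrow> a = 0)"

definition density_space :: "('a::unital_cstar_algebra \<Rightarrow> complex) \<Rightarrow> 'a set" where
  "density_space \<tau> = {a \<in> positive_elements. \<tau> a = 1}"

definition density_state ::
    "('a::unital_cstar_algebra \<Rightarrow> complex) \<Rightarrow> 'a \<Rightarrow> 'a \<Rightarrow> complex" where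
  "density_state \<tau> a = (\<lambda>b. \<tau> (a * b))"

definition quantum_metric ::
    "('a::unital_cstar_algebra \<Rightarrow> ennreal) \<Rightarrow> ('a \<Rightarrow> complex) \<Rightarrow> 'a \<Rightarrow> 'a \<Rightarrow> real" where
  "quantum_metric L \<tau> x y = enn2real (mk L (density_state \<tau> x) (density_state \<tau> y))"

definition cstar_norm_metric :: "'a::unital_cstar_algebra \<Rightarrow> 'a \<Rightarrow> real" where
  "cstar_norm_metric x y = norm (x - y)"

definition topologically_equivalent ::
    "'b set \<Rightarrow> ('b \<Rightarrow> 'b \<Rightarrow> real) \<Rightarrow> ('b \<Rightarrow> 'b \<Rightarrow> real) \<Rightarrow> bool" where
  "topologically_equivalent M d d' \<longleftrightarrow>
     Metric_space M d \<and> Metric_space M d' \<and>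
     Metric_space.mtopology M d = Metric_space.mtopology M d'"

end

theory Submission
  imports Defs
begin

text \<open>
  Metric topologies are determined by their convergent sequences, and on a finite-dimensional
  space weak convergence of sequences agrees with norm convergence.

  The quantum metric is the pullback of the Monge--Kantorovich metric along the injection
  \<open>x \<mapsto> \<tau>(x \<cdot>)\<close> of the density space into the state space. Since the
  Monge--Kantorovich metric metrizes the weak* topology, \<open>x\<^sub>n \<longlonglongrightarrow> x\<close> for the quantum metric
  means that \<open>\<tau>(x\<^sub>n b) \<longlonglongrightarrow> \<tau>(x b)\<close> for every \<open>b\<close>
  (\<open>quantum_metric_tendsto_iff\<close>). It remains to compare this with \<open>\<parallel>x\<^sub>n - x\<parallel> \<longlonglongrightarrow> 0\<close>
  (\<open>trace_pairing_tendsto_iff_norm_tendsto\<close>).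

  Let \<open>B\<close> be a finite spanning set. As \<open>\<tau>\<close> is faithful, the trace pairing
  \<open>(x, b) \<mapsto> \<tau>(x b)\<close> is nondegenerate, so \<open>q(x) = \<Sum>b\<in>B. \<bar>\<tau>(x b)\<bar>\<close> is a norm. On a
  finite-dimensional space every norm dominates every seminorm up to a constant
  (\<open>dominates_seminorm\<close>). Applied to \<open>q\<close> and the C*-norm, this shows that weak convergence
  implies norm convergence; applied to the C*-norm and the seminorm \<open>\<bar>\<tau>(x b)\<bar>\<close>, it gives the
  converse, whose content is the continuity of \<open>\<tau>\<close>.
\<close>

section \<open>Norms on finite-dimensional complex vector spaces\<close>

locale complex_seminorm = vector_space scale
  for scale :: "complex \<Rightarrow> 'v::ab_group_add \<Rightarrow> 'v" +
  fixes p :: "'v \<Rightarrow> real"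
  assumes triangle: "p (x + y) \<le> p x + p y"
    and homogeneous: "p (scale c x) = cmod c * p x"
begin

lemma zero: "p 0 = 0"
  using homogeneous[of 0 0] by simp

lemma nonneg: "0 \<le> p x"
proof -
  have "p (- x) = p x"
    using homogeneous[of "-1" x] by simp
  then show ?thesis
    using triangle[of x "- x"] zero by simp
qed

lemma sum_le: "p (\<Sum>b\<in>B. scale (c b) b) \<le> (\<Sum>b\<in>B. cmod (c b) * p b)"
proof (induction B rule: infinite_finite_induct)
  case (insert b B)
  then show ?case
    using triangle[of "scale (c b) b" "\<Sum>b\<in>B. scale (c b) b"] by (simp add: homogeneous)
qed (simp_all add: zero)

end

locale complex_norm = complex_seminorm +
  assumes definite: "p x = 0 \<Longrightarrow> x = 0"
begin

text \<open>
  Compactness of the unit sphere of coefficient vectors: if no constant worked, there would be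
  coefficient vectors of total modulus 1 whose linear combinations tend to zero. A subsequence
  converges coefficientwise, and its limit is a nontrivial linear relation between elements
  of the independent set.
\<close>

lemma coefficients_bounded:
  assumes "finite B" and "independent B"
  shows "\<exists>C. \<forall>c. (\<Sum>b\<in>B. cmod (c b)) \<le> C * p (\<Sum>b\<in>B. scale (c b) b)"
proof (rule ccontr)
  assume "\<not> ?thesis"
  then have "\<forall>n. \<exists>c. real (Suc n) * p (\<Sum>b\<in>B. scale (c b) b) < (\<Sum>b\<in>B. cmod (c b))"
    by (metis not_le)
  then obtain c where
    c: "real (Suc n) * p (\<Sum>b\<in>B. scale (c n b) b) < (\<Sum>b\<in>B. cmod (c n b))" for n
    by metis
  define s where "s n = (\<Sum>b\<in>B. cmod (c n b))" for n
  have s_pos: "s n > 0" for n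
    using c[of n] nonneg[of "\<Sum>b\<in>B. scale (c n b) b"]
    unfolding s_def by (smt (verit) mult_nonneg_nonneg of_nat_0_le_iff)
  define u where "u n b = c n b / complex_of_real (s n)" for n b
  have u_sum: "(\<Sum>b\<in>B. cmod (u n b)) = 1" for n
    using s_pos[of n]
    by (simp add: u_def norm_divide s_def[symmetric] flip: sum_divide_distrib)
  have u_small: "p (\<Sum>b\<in>B. scale (u n b) b) \<le> inverse (real (Suc n))" for n
  proof -
    have "(\<Sum>b\<in>B. scale (u n b) b) = scale (inverse (complex_of_real (s n))) (\<Sum>b\<in>B. scale (c n b) b)"
      by (simp add: u_def scale_sum_right divide_inverse mult.commute)
    then have "p (\<Sum>b\<in>B. scale (u n b) b) = p (\<Sum>b\<in>B. scale (c n b) b) / s n"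
      using s_pos[of n] by (simp add: homogeneous norm_inverse divide_inverse)
    also have "\<dots> \<le> (s n / real (Suc n)) / s n"
      using c[of n] s_pos[of n] unfolding s_def[symmetric]
      by (intro divide_right_mono) (auto simp: pos_le_divide_eq mult.commute simp del: of_nat_Suc)
    also have "\<dots> = inverse (real (Suc n))"
      using s_pos[of n] by (simp add: inverse_eq_divide del: of_nat_Suc)
    finally show ?thesis .
  qed
  have u_le: "cmod (u n b) \<le> 1" if "b \<in> B" for n b
    using member_le_sum[OF that, of "\<lambda>b. cmod (u n b)"] u_sum[of n] assms(1) by simp
  have "\<forall>d\<subseteq>B. \<exists>l r. strict_mono (r::nat\<Rightarrow>nat) \<and>
      (\<forall>e>0. \<forall>\<^sub>F n in sequentially. \<forall>b\<in>d. dist (u (r n) b) (l b) < e)"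
    by (rule compact_lemma_general[where unproj = id])
      (use assms(1) u_le in \<open>auto simp: bounded_iff\<close>)
  then obtain l and r :: "nat \<Rightarrow> nat" where r: "strict_mono r"
    and l: "\<And>e. e > 0 \<Longrightarrow> \<forall>\<^sub>F n in sequentially. \<forall>b\<in>B. dist (u (r n) b) (l b) < e"
    by blast
  have lim: "(\<lambda>n. u (r n) b) \<longlonglongrightarrow> l b" if "b \<in> B" for b
    unfolding tendsto_iff using that by (auto intro: eventually_mono[OF l])
  have "(\<lambda>n. \<Sum>b\<in>B. cmod (u (r n) b)) \<longlonglongrightarrow> (\<Sum>b\<in>B. cmod (l b))"
    by (intro tendsto_sum tendsto_norm lim)
  then have l_sum: "(\<Sum>b\<in>B. cmod (l b)) = 1"
    by (simp add: u_sum LIMSEQ_const_iff)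
  have "p (\<Sum>b\<in>B. scale (l b) b) \<le>
      (\<Sum>b\<in>B. cmod (l b - u (r n) b) * p b) + inverse (real (Suc (r n)))" for n
  proof -
    have "(\<Sum>b\<in>B. scale (l b) b) =
        (\<Sum>b\<in>B. scale (l b - u (r n) b) b) + (\<Sum>b\<in>B. scale (u (r n) b) b)"
      by (simp add: scale_left_diff_distrib sum_subtractf)
    then show ?thesis
      using triangle[of "\<Sum>b\<in>B. scale (l b - u (r n) b) b" "\<Sum>b\<in>B. scale (u (r n) b) b"]
        sum_le[of "\<lambda>b. l b - u (r n) b" B] u_small[of "r n"]
      by simp
  qed
  moreover have "(\<lambda>n. (\<Sum>b\<in>B. cmod (l b - u (r n) b) * p b) + inverse (real (Suc (r n))))
      \<longlonglongrightarrow> (\<Sum>b\<in>B. cmod (l b - l b) * p b) + 0"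
    by (intro tendsto_add tendsto_sum tendsto_mult tendsto_norm tendsto_diff tendsto_const lim
        LIMSEQ_subseq_LIMSEQ[OF LIMSEQ_inverse_real_of_nat r, unfolded o_def]) auto
  ultimately have "p (\<Sum>b\<in>B. scale (l b) b) \<le> 0"
    by (intro LIMSEQ_le_const[where X = "\<lambda>n. (\<Sum>b\<in>B. cmod (l b - u (r n) b) * p b) +
        inverse (real (Suc (r n)))"]) auto
  then have "(\<Sum>b\<in>B. scale (l b) b) = 0"
    using nonneg[of "\<Sum>b\<in>B. scale (l b) b"] definite by simp
  then have "\<forall>b\<in>B. l b = 0"
    using assms dependent_finite[of B] by blast
  then show False
    using l_sum by simp
qed

text \<open>
  Expanding in a basis, a seminorm is bounded by the sum of the moduli of the coefficients,
  which in turn is bounded by the norm.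
\<close>

lemma dominates_seminorm:
  assumes "finite B" and "span B = UNIV" and "complex_seminorm scale p'"
  shows "\<exists>C. \<forall>x. p' x \<le> C * p x"
proof -
  interpret p': complex_seminorm scale p'
    by (rule assms)
  obtain B' where B': "B' \<subseteq> B" "independent B'" "B \<subseteq> span B'"
    by (rule maximal_independent_subset)
  have fin: "finite B'"
    using B'(1) assms(1) finite_subset by blast
  have span: "span B' = UNIV"
    using B'(3) assms(2) span_minimal[OF _ subspace_span] by blast
  obtain C where C: "\<And>c. (\<Sum>b\<in>B'. cmod (c b)) \<le> C * p (\<Sum>b\<in>B'. scale (c b) b)"
    using coefficients_bounded[OF fin B'(2)] by blast
  define K where "K = (\<Sum>b\<in>B'. p' b)"
  have "p' x \<le> (K * C) * p x" for x
  proof -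
    obtain c where x: "x = (\<Sum>b\<in>B'. scale (c b) b)"
      using span span_finite[OF fin] by blast
    have "p' x \<le> (\<Sum>b\<in>B'. cmod (c b) * p' b)"
      unfolding x by (rule p'.sum_le)
    also have "\<dots> \<le> (\<Sum>b\<in>B'. cmod (c b) * K)"
      unfolding K_def using fin
      by (intro sum_mono mult_left_mono member_le_sum) (auto simp: p'.nonneg)
    also have "\<dots> = K * (\<Sum>b\<in>B'. cmod (c b))"
      by (simp add: sum_distrib_left mult.commute)
    also have "\<dots> \<le> K * (C * p x)"
      unfolding x K_def by (intro mult_left_mono C sum_nonneg p'.nonneg)
    finally show ?thesis
      by (simp add: mult.assoc)
  qed
  then show ?thesis
    by blast
qed

end

lemma complex_norm_norm:
  "complex_norm scaleC (norm :: 'a::unital_cstar_algebra \<Rightarrow> real)"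
  by unfold_locales (auto simp: norm_scaleC norm_triangle_ineq)

section \<open>The trace pairing\<close>

context
  fixes \<tau> :: "'a::unital_cstar_algebra \<Rightarrow> complex"
  assumes \<tau>: "faithful_trace \<tau>"
begin

lemma trace_add: "\<tau> (x + y) = \<tau> x + \<tau> y"
  and trace_scaleC: "\<tau> (c *\<^sub>C x) = c * \<tau> x"
  using \<tau> unfolding faithful_trace_def positive_functional_def Vector_Spaces.linear_iff by auto

lemma trace_diff: "\<tau> (x - y) = \<tau> x - \<tau> y"
  using trace_add[of "x - y" y] by (simp add: algebra_simps)

lemma trace_commute: "\<tau> (x * y) = \<tau> (y * x)"
  using \<tau> unfolding faithful_trace_def by blast

lemma trace_pairing_nondegenerate:
  assumes "\<And>b. \<tau> (x * b) = 0"
  shows "x = 0"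
proof -
  have "\<tau> (star x * x) = 0"
    using assms[of "star x"] trace_commute[of x "star x"] by simp
  then show ?thesis
    using \<tau> unfolding faithful_trace_def by blast
qed

text \<open>
  Positivity uses traciality to avoid square roots: with \<open>a = y\<^sup>* y\<close>, cyclicity gives
  \<open>\<tau>(y\<^sup>* y c\<^sup>* c) = \<tau>((y c\<^sup>*)\<^sup>* (y c\<^sup>*))\<close>.
\<close>

lemma density_state_in_state_space:
  assumes "a \<in> density_space \<tau>"
  shows "density_state \<tau> a \<in> state_space"
proof -
  obtain y where y: "a = star y * y" and tr: "\<tau> a = 1"
    using assms unfolding density_space_def positive_elements_def by auto
  have "\<tau> (a * (star c * c)) \<in> \<real>\<^sub>\<ge>\<^sub>0" for c
  proof -
    have "\<tau> (a * (star c * c)) = \<tau> (c * (star y * y * star c))"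
      by (metis y trace_commute mult.assoc)
    also have "\<dots> = \<tau> (star (y * star c) * (y * star c))"
      by (simp add: star_mult star_star mult.assoc)
    finally show ?thesis
      using \<tau> unfolding faithful_trace_def positive_functional_def positive_elements_def by auto
  qed
  moreover have "Vector_Spaces.linear scaleC (*) (density_state \<tau> a)"
    unfolding Vector_Spaces.linear_iff density_state_def
    by (simp add: complex_vector.vector_space_axioms trace_add trace_scaleC distrib_left
        mult_scaleC_right vector_space_over_itself.vector_space_axioms)
  ultimately show ?thesis
    unfolding state_space_def positive_functional_def positive_elements_def density_state_def
    using tr by auto
qed

lemma density_state_eq_iff: "density_state \<tau> x = density_state \<tau> y \<longleftrightarrow> x = y"
proof
  assume "density_state \<tau> x = density_state \<tau> y"
  then have "\<tau> ((x - y) * b) = 0" for b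
    unfolding density_state_def by (metis left_diff_distrib right_minus_eq trace_diff)
  then show "x = y"
    using trace_pairing_nondegenerate[of "x - y"] by simp
qed simp

lemma trace_pairing_seminorm: "complex_seminorm scaleC (\<lambda>x. cmod (\<tau> (x * b)))"
  by unfold_locales
    (auto simp: trace_add trace_scaleC distrib_right mult_scaleC_left norm_mult norm_triangle_ineq)

lemma trace_pairing_norm:
  assumes "finite B" and "complex_vector.span B = UNIV"
  shows "complex_norm scaleC (\<lambda>x. \<Sum>b\<in>B. cmod (\<tau> (x * b)))"
proof
  fix x y :: 'a and c :: complex
  show "(\<Sum>b\<in>B. cmod (\<tau> ((x + y) * b))) \<le> (\<Sum>b\<in>B. cmod (\<tau> (x * b))) + (\<Sum>b\<in>B. cmod (\<tau> (y * b)))"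
    by (simp add: distrib_right trace_add norm_triangle_ineq sum_mono flip: sum.distrib)
  show "(\<Sum>b\<in>B. cmod (\<tau> (c *\<^sub>C x * b))) = cmod c * (\<Sum>b\<in>B. cmod (\<tau> (x * b)))"
    by (simp add: mult_scaleC_left trace_scaleC norm_mult sum_distrib_left)
  assume "(\<Sum>b\<in>B. cmod (\<tau> (x * b))) = 0"
  then have B: "\<tau> (x * b) = 0" if "b \<in> B" for b
    using assms(1) that by (simp add: sum_nonneg_eq_0_iff)
  \<comment> \<open>The elements pairing to zero with \<open>x\<close> form a subspace containing the spanning set.\<close>
  have "complex_vector.subspace {b. \<tau> (x * b) = 0}"
    using trace_scaleC[of 0 0]
    by (auto simp: complex_vector.subspace_def distrib_left trace_add mult_scaleC_right
        trace_scaleC)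
  then have "complex_vector.span B \<subseteq> {b. \<tau> (x * b) = 0}"
    using B by (intro complex_vector.span_minimal) auto
  then show "x = 0"
    using trace_pairing_nondegenerate[of x] assms(2) by blast
qed

lemma trace_pairing_tendsto_iff_norm_tendsto:
  fixes B :: "'a set"
  assumes "finite B" and "complex_vector.span B = UNIV"
  shows "(\<forall>b. ((\<lambda>n. \<tau> (f n * b)) \<longlongrightarrow> \<tau> (x * b)) F) \<longleftrightarrow> ((\<lambda>n. norm (f n - x)) \<longlongrightarrow> 0) F"
    (is "?weak \<longleftrightarrow> ?norm")
proof
  assume ?weak
  interpret q: complex_norm scaleC "\<lambda>x. \<Sum>b\<in>B. cmod (\<tau> (x * b))"
    using assms by (rule trace_pairing_norm)
  have "complex_seminorm scaleC (norm :: 'a \<Rightarrow> real)"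
    using complex_norm_norm by (rule complex_norm.axioms)
  then obtain C where C: "\<And>y. norm y \<le> C * (\<Sum>b\<in>B. cmod (\<tau> (y * b)))"
    using q.dominates_seminorm[OF assms] by blast
  have "((\<lambda>n. cmod (\<tau> ((f n - x) * b))) \<longlongrightarrow> 0) F" for b
    using \<open>?weak\<close> by (auto simp: left_diff_distrib trace_diff tendsto_norm_zero_iff LIM_zero_iff)
  then have "((\<lambda>n. C * (\<Sum>b\<in>B. cmod (\<tau> ((f n - x) * b)))) \<longlongrightarrow> 0) F"
    by (intro tendsto_mult_right_zero tendsto_null_sum) auto
  then show ?norm
    by (rule Lim_null_comparison[rotated]) (use C in auto)
next
  assume ?norm
  interpret n: complex_norm scaleC "norm :: 'a \<Rightarrow> real"
    by (rule complex_norm_norm)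
  show ?weak
  proof
    fix b
    obtain C where C: "\<And>y. cmod (\<tau> (y * b)) \<le> C * norm y"
      using n.dominates_seminorm[OF assms trace_pairing_seminorm] by blast
    have "((\<lambda>n. C * norm (f n - x)) \<longlongrightarrow> 0) F"
      using \<open>?norm\<close> by (rule tendsto_mult_right_zero)
    then have "((\<lambda>n. \<tau> ((f n - x) * b)) \<longlongrightarrow> 0) F"
      by (rule Lim_null_comparison[rotated]) (use C in auto)
    then show "((\<lambda>n. \<tau> (f n * b)) \<longlongrightarrow> \<tau> (x * b)) F"
      by (simp add: left_diff_distrib trace_diff LIM_zero_iff)
  qed
qed

end

section \<open>Comparison of the metrics\<close>

lemma Metric_space_pullback:
  assumes "Metric_space M d" and "inj_on f D" and "f ` D \<subseteq> M"
  shows "Metric_space D (\<lambda>x y. d (f x) (f y))"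
proof -
  interpret Metric_space M d
    by (rule assms)
  show ?thesis
    using assms(2,3)
    by unfold_locales (auto simp: commute image_subset_iff inj_on_eq_iff intro: triangle)
qed

lemma topologically_equivalent_if_same_limits:
  assumes "Metric_space M d" and "Metric_space M d'"
    and "\<And>\<sigma> x. range \<sigma> \<subseteq> M \<Longrightarrow> x \<in> M \<Longrightarrow>
      (\<lambda>n::nat. d (\<sigma> n) x) \<longlonglongrightarrow> 0 \<longleftrightarrow> (\<lambda>n. d' (\<sigma> n) x) \<longlonglongrightarrow> 0"
  shows "topologically_equivalent M d d'"
proof -
  interpret d: Metric_space M d
    by (rule assms)
  interpret d': Metric_space M d'
    by (rule assms)
  have "limitin d.mtopology \<sigma> x sequentially \<longleftrightarrow> limitin d'.mtopology \<sigma> x sequentially"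
    if "range \<sigma> \<subseteq> M" for \<sigma> x
    unfolding d.limitin_metric_dist_null d'.limitin_metric_dist_null
    using assms(3)[OF that] by blast
  then have "closedin d.mtopology S \<longleftrightarrow> closedin d'.mtopology S" for S
    unfolding d.metric_closedin_iff_sequentially_closed d'.metric_closedin_iff_sequentially_closed
    by (meson subset_trans)
  then have "d.mtopology = d'.mtopology"
    unfolding topology_eq by (simp add: openin_closedin_eq)
  then show ?thesis
    using assms(1,2) unfolding topologically_equivalent_def by blast
qed

lemma limitin_weak_star_topology:
  "limitin weak_star_topology f \<phi> F \<longleftrightarrow>
    \<phi> \<in> state_space \<and> (\<forall>\<^sub>F n in F. f n \<in> state_space) \<and> (\<forall>b. ((\<lambda>n. f n b) \<longlongrightarrow> \<phi> b) F)"
  unfolding weak_star_topology_def limitin_subtopology limitin_componentwise by simp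

context compact_quantum_metric_space
begin

text \<open>
  The condition that the Monge--Kantorovich metric metrizes the weak* topology, read along
  the embedding of the density space into the state space.
\<close>

lemma quantum_metric_tendsto_iff:
  assumes \<tau>: "faithful_trace \<tau>" and "range f \<subseteq> density_space \<tau>" and "x \<in> density_space \<tau>"
  shows "(\<lambda>n::nat. quantum_metric L \<tau> (f n) x) \<longlonglongrightarrow> 0 \<longleftrightarrow>
    (\<forall>b. (\<lambda>n. \<tau> (f n * b)) \<longlonglongrightarrow> \<tau> (x * b))"
proof -
  interpret mk: Metric_space state_space "\<lambda>\<phi> \<psi>. enn2real (mk L \<phi> \<psi>)"
    by (rule mk_metric)
  have states: "density_state \<tau> (f n) \<in> state_space" "density_state \<tau> x \<in> state_space" for n
    using assms by (auto intro: density_state_in_state_space)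
  have "(\<lambda>n. quantum_metric L \<tau> (f n) x) \<longlonglongrightarrow> 0 \<longleftrightarrow>
      limitin mk.mtopology (\<lambda>n. density_state \<tau> (f n)) (density_state \<tau> x) sequentially"
    unfolding mk.limitin_metric_dist_null quantum_metric_def using states by simp
  also have "\<dots> \<longleftrightarrow> (\<forall>b. (\<lambda>n. density_state \<tau> (f n) b) \<longlonglongrightarrow> density_state \<tau> x b)"
    unfolding mk_metrizes limitin_weak_star_topology using states by simp
  finally show ?thesis
    unfolding density_state_def .
qed

lemma Metric_space_quantum_metric:
  assumes "faithful_trace \<tau>"
  shows "Metric_space (density_space \<tau>) (quantum_metric L \<tau>)"
  unfolding quantum_metric_def
  by (rule Metric_space_pullback[OF mk_metric])
    (auto simp: inj_on_def density_state_eq_iff[OF assms] density_state_in_state_space[OF assms])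

end

lemma Metric_space_cstar_norm_metric: "Metric_space D cstar_norm_metric"
  using Metric_space.subspace[OF Met_TC.Metric_space_axioms, of D]
  by (simp add: cstar_norm_metric_def[abs_def] dist_norm[abs_def])

theorem theorem3p4:
  fixes L :: "'a::unital_cstar_algebra \<Rightarrow> ennreal" and \<tau> :: "'a \<Rightarrow> complex"
  assumes "compact_quantum_metric_space L"
    and "faithful_trace \<tau>"
    and "\<exists>B::'a set. finite B \<and> complex_vector.span B = UNIV"
  shows "topologically_equivalent (density_space \<tau>) (quantum_metric L \<tau>) cstar_norm_metric"
proof -
  interpret compact_quantum_metric_space L
    by (rule assms)
  obtain B :: "'a set" where B: "finite B" "complex_vector.span B = UNIV"
    using assms(3) by blast
  show ?thesis
  proof (rule topologically_equivalent_if_same_limits)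
    fix \<sigma> :: "nat \<Rightarrow> 'a" and x
    assume "range \<sigma> \<subseteq> density_space \<tau>" "x \<in> density_space \<tau>"
    then show "(\<lambda>n. quantum_metric L \<tau> (\<sigma> n) x) \<longlonglongrightarrow> 0 \<longleftrightarrow> (\<lambda>n. cstar_norm_metric (\<sigma> n) x) \<longlonglongrightarrow> 0"
      unfolding cstar_norm_metric_def
      using quantum_metric_tendsto_iff[OF assms(2)]
        trace_pairing_tendsto_iff_norm_tendsto[OF assms(2) B]
      by simp
  qed (simp_all add: Metric_space_quantum_metric assms(2) Metric_space_cstar_norm_metric)
qed

end
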